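(* Let $\ell, v, \hat v, y$ be $\{0,1\}$-valued random variables on a common probability space. For $l\in\{0,1\}$ define $p_l, r_l$ by $\Pr[v=1\mid \hat v=1,\ell=l]=1-p_l$ and $\Pr[\hat v=1\mid v=1,\ell=l]=1-r_l$. Let $\varepsilon_{B1}\in[0,1]$ be the smallest constant such that for each $l\in\{0,1\}$ $$\Big|\Pr[y=1\mid v=1,\hat v=0,\ell=l]-\Pr[y=1\mid v=0,\hat v=1,\ell=l]\Big|\le\varepsilon_{B1},$$ and suppose that $|r_0-p_0|\le\gamma_{B1}$ and $|r_1-p_1|\le\gamma_{B1}$. Then $$|G-\hat G|\le 2(\gamma_{B1}+\varepsilon_{B1}).$$
   Context: $\ell$ is a sensitive attribute, $v$ a covariate, $\hat v$ a proxy for $v$, and $y$ a predicted outcome. The true and estimated conditional statistical parity gaps are $$G=\Pr[y=1\mid v=1,\ell=1]-\Pr[y=1\mid v=1,\ell=0],$$ $$\hat G=\Pr[y=1\mid \hat v=1,\ell=1]-\Pr[y=1\mid \hat v=1,\ell=0].$$ Every conditional probability that appears is assumed to be well defined, i.e. its conditioning event has positive probability. *)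

theory Defs
  imports "HOL-Probability.Probability"
begin

text \<open>
  The conditional statistical parity gap with respect to a covariate \<open>w\<close>:
  the true gap is obtained for \<open>w = v\<close>, the estimated gap for the proxy \<open>w = vh\<close>.
  The library's conditional probability is a quotient, hence \<open>0\<close> if the conditioning
  event is null; positivity has to be assumed where it is used.
\<close>
definition parity_gap ::
  "'a measure \<Rightarrow> ('a \<Rightarrow> nat) \<Rightarrow> ('a \<Rightarrow> nat) \<Rightarrow> ('a \<Rightarrow> nat) \<Rightarrow> real" where
  "parity_gap M ell w y =
     \<P>(x in M. y x = 1 \<bar> w x = 1 \<and> ell x = 1) - \<P>(x in M. y x = 1 \<bar> w x = 1 \<and> ell x = 0)"

definition proxy_disparity_bound ::
  "'a measure \<Rightarrow> ('a \<Rightarrow> nat) \<Rightarrow> ('a \<Rightarrow> nat) \<Rightarrow> ('a \<Rightarrow> nat) \<Rightarrow> ('a \<Rightarrow> nat) \<Rightarrow> real \<Rightarrow> bool" where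
  "proxy_disparity_bound M ell v vh y e \<longleftrightarrow>
     (\<forall>l\<in>{0, 1}. \<bar>\<P>(x in M. y x = 1 \<bar> v x = 1 \<and> vh x = 0 \<and> ell x = l)
                - \<P>(x in M. y x = 1 \<bar> v x = 0 \<and> vh x = 1 \<and> ell x = l)\<bar> \<le> e)"

end

theory Submission
  imports Defs
begin

text \<open>
  Split both conditioning events along the proxy and the covariate. Within one group let \<open>q\<close>, \<open>b\<close>, \<open>c\<close>
  be the rates of \<open>y = 1\<close> given that \<open>(v, vh)\<close> is \<open>(1, 1)\<close>, \<open>(1, 0)\<close>, \<open>(0, 1)\<close>. The true and
  estimated rates are \<open>(1 - r) q + r b\<close> and \<open>(1 - p) q + p c\<close>, whose difference is
  \<open>(p - r) (q - c) + r (b - c)\<close>, hence at most \<open>\<bar>r - p\<bar> + \<bar>b - c\<bar>\<close>. Sum over the two groups.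
\<close>

lemma abs_mixture_diff_le:
  fixes p q r b c :: real
  assumes "q \<in> {0..1}" "c \<in> {0..1}" "r \<in> {0..1}"
  shows "\<bar>((1 - r) * q + r * b) - ((1 - p) * q + p * c)\<bar> \<le> \<bar>r - p\<bar> + \<bar>b - c\<bar>"
proof -
  have "\<bar>((1 - r) * q + r * b) - ((1 - p) * q + p * c)\<bar> = \<bar>(p - r) * (q - c) + r * (b - c)\<bar>"
    by (simp add: algebra_simps)
  also have "\<dots> \<le> \<bar>p - r\<bar> * \<bar>q - c\<bar> + r * \<bar>b - c\<bar>"
    using assms(3) abs_triangle_ineq[of "(p - r) * (q - c)" "r * (b - c)"] by (simp add: abs_mult)
  also have "\<dots> \<le> \<bar>p - r\<bar> * 1 + 1 * \<bar>b - c\<bar>"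
    using assms by (intro add_mono mult_mono) auto
  finally show ?thesis
    by (simp add: abs_minus_commute)
qed

context prob_space
begin

lemma cond_prob_range: "\<P>(x in M. P x \<bar> Q x) \<in> {0..1}" if "{x \<in> space M. Q x} \<in> events"
proof -
  have "prob {x \<in> space M. P x \<and> Q x} \<le> prob {x \<in> space M. Q x}"
    using that by (intro finite_measure_mono) auto
  \<comment> \<open>If the conditioning event is null, the quotient is 0 by convention, which lies
    in the interval as well.\<close>
  then show ?thesis
    by (simp add: cond_prob_def divide_le_eq_1 less_le)
qed

text \<open>Over a null conditioning event both sides are 0, by monotonicity. The product form
  therefore also covers null parts when an event is split.\<close>

lemma cond_prob_mult:
  assumes "{x \<in> space M. Q x} \<in> events"
  shows "\<P>(x in M. P x \<bar> Q x) * prob {x \<in> space M. Q x} = prob {x \<in> space M. P x \<and> Q x}"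
proof (cases "prob {x \<in> space M. Q x} = 0")
  case True
  have "prob {x \<in> space M. P x \<and> Q x} \<le> prob {x \<in> space M. Q x}"
    using assms by (intro finite_measure_mono) auto
  with True show ?thesis
    by (simp add: measure_le_0_iff)
qed (simp add: cond_prob_def)

text \<open>Law of total probability under conditioning on \<open>Q\<close>. A part that is null
  given \<open>Q\<close> gets weight 0, so the default value of its conditional rate has no
  effect.\<close>

lemma cond_prob_split:
  assumes [measurable]: "Measurable.pred M Y" "Measurable.pred M Q" "Measurable.pred M W"
    and pos: "\<P>(x in M. Q x) > 0"
  defines "a \<equiv> \<P>(x in M. W x \<bar> Q x)"
  shows "\<P>(x in M. Y x \<bar> Q x) =
    a * \<P>(x in M. Y x \<bar> W x \<and> Q x) + (1 - a) * \<P>(x in M. Y x \<bar> \<not> W x \<and> Q x)"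
proof -
  have split: "\<P>(x in M. P x) = \<P>(x in M. P x \<and> W x) + \<P>(x in M. P x \<and> \<not> W x)"
    if [measurable]: "Measurable.pred M P" for P
    by (subst finite_measure_Union[symmetric]) (auto intro!: arg_cong[of _ _ prob])
  have a: "\<P>(x in M. W x \<and> Q x) = a * \<P>(x in M. Q x)"
    unfolding a_def by (simp add: cond_prob_mult)
  moreover have "\<P>(x in M. Q x) = \<P>(x in M. W x \<and> Q x) + \<P>(x in M. \<not> W x \<and> Q x)"
    using split[of Q] by (simp add: conj_commute)
  ultimately have a': "\<P>(x in M. \<not> W x \<and> Q x) = (1 - a) * \<P>(x in M. Q x)"
    by (simp add: algebra_simps)
  have "\<P>(x in M. Y x \<and> Q x) = \<P>(x in M. Y x \<and> W x \<and> Q x) + \<P>(x in M. Y x \<and> \<not> W x \<and> Q x)"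
    using split[of "\<lambda>x. Y x \<and> Q x"] by (simp add: conj_commute conj_left_commute)
  \<comment> \<open>Read backwards, \<open>a\<close> and \<open>a'\<close> turn the weights into the
    probabilities of the two parts, so that \<open>cond_prob_mult\<close> applies to each
    term.\<close>
  also have "\<dots> = \<P>(x in M. Y x \<bar> W x \<and> Q x) * (a * \<P>(x in M. Q x))
      + \<P>(x in M. Y x \<bar> \<not> W x \<and> Q x) * ((1 - a) * \<P>(x in M. Q x))"
    unfolding a[symmetric] a'[symmetric] by (simp add: cond_prob_mult)
  also have "\<dots> = (a * \<P>(x in M. Y x \<bar> W x \<and> Q x) + (1 - a) * \<P>(x in M. Y x \<bar> \<not> W x \<and> Q x))
      * \<P>(x in M. Q x)"
    by (simp add: algebra_simps)
  \<comment> \<open>Positivity of \<open>Q\<close> allows division by its probability.\<close>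
  finally show ?thesis
    using pos by (simp add: cond_prob_def[of M Y Q])
qed

text \<open>The estimate for a single group \<open>L\<close>. The two conditioning events overlap
  where \<open>V\<close> and \<open>W\<close> both hold, so both mixtures share the rate
  \<open>q\<close>. Negations describe the other cells because \<open>cond_prob_split\<close> works
  with complements.\<close>

lemma abs_cond_prob_diff_le:
  assumes [measurable]: "Measurable.pred M Y" "Measurable.pred M V" "Measurable.pred M W"
      "Measurable.pred M L"
    and "\<P>(x in M. V x \<and> L x) > 0" "\<P>(x in M. W x \<and> L x) > 0"
  shows "\<bar>\<P>(x in M. Y x \<bar> V x \<and> L x) - \<P>(x in M. Y x \<bar> W x \<and> L x)\<bar> \<le>
    \<bar>\<P>(x in M. W x \<bar> V x \<and> L x) - \<P>(x in M. V x \<bar> W x \<and> L x)\<bar> +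
    \<bar>\<P>(x in M. Y x \<bar> V x \<and> \<not> W x \<and> L x) - \<P>(x in M. Y x \<bar> \<not> V x \<and> W x \<and> L x)\<bar>"
proof -
  define r where "r = 1 - \<P>(x in M. W x \<bar> V x \<and> L x)"
  define p where "p = 1 - \<P>(x in M. V x \<bar> W x \<and> L x)"
  define q where "q = \<P>(x in M. Y x \<bar> V x \<and> W x \<and> L x)"
  define b where "b = \<P>(x in M. Y x \<bar> V x \<and> \<not> W x \<and> L x)"
  define c where "c = \<P>(x in M. Y x \<bar> \<not> V x \<and> W x \<and> L x)"
  have "\<P>(x in M. Y x \<bar> V x \<and> L x) = (1 - r) * q + r * b"
    using cond_prob_split[of Y "\<lambda>x. V x \<and> L x" W] assms(5)
    by (simp add: r_def q_def b_def conj_left_commute)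
  moreover have "\<P>(x in M. Y x \<bar> W x \<and> L x) = (1 - p) * q + p * c"
    using cond_prob_split[of Y "\<lambda>x. W x \<and> L x" V] assms(6)
    by (simp add: p_def q_def c_def)
  moreover have "q \<in> {0..1}" "c \<in> {0..1}"
    unfolding q_def c_def by (auto simp del: atLeastAtMost_iff intro!: cond_prob_range)
  moreover have "r \<in> {0..1}"
    using cond_prob_range[of "\<lambda>x. V x \<and> L x" W] by (simp add: r_def)
  ultimately have "\<bar>\<P>(x in M. Y x \<bar> V x \<and> L x) - \<P>(x in M. Y x \<bar> W x \<and> L x)\<bar> \<le> \<bar>r - p\<bar> + \<bar>b - c\<bar>"
    using abs_mixture_diff_le[of q c r b p] by simp
  then show ?thesis
    by (simp add: r_def p_def b_def c_def abs_minus_commute)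
qed

end

theorem theorem6p2:
  fixes M :: "'a measure" and ell v vh y :: "'a \<Rightarrow> nat"
    and p r :: "nat \<Rightarrow> real" and \<epsilon> \<gamma> :: real
  assumes "prob_space M"
    and "ell \<in> measurable M (count_space {0, 1})"
    and "v \<in> measurable M (count_space {0, 1})"
    and "vh \<in> measurable M (count_space {0, 1})"
    and "y \<in> measurable M (count_space {0, 1})"
    and "\<And>l. l \<in> {0, 1} \<Longrightarrow> \<P>(x in M. v x = 1 \<and> ell x = l) > 0"
    and "\<And>l. l \<in> {0, 1} \<Longrightarrow> \<P>(x in M. vh x = 1 \<and> ell x = l) > 0"
    and "\<And>l. l \<in> {0, 1} \<Longrightarrow> \<P>(x in M. v x = 1 \<and> vh x = 0 \<and> ell x = l) > 0"
    and "\<And>l. l \<in> {0, 1} \<Longrightarrow> \<P>(x in M. v x = 0 \<and> vh x = 1 \<and> ell x = l) > 0"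
    and "\<And>l. l \<in> {0, 1} \<Longrightarrow> \<P>(x in M. v x = 1 \<bar> vh x = 1 \<and> ell x = l) = 1 - p l"
    and "\<And>l. l \<in> {0, 1} \<Longrightarrow> \<P>(x in M. vh x = 1 \<bar> v x = 1 \<and> ell x = l) = 1 - r l"
    and "\<epsilon> \<in> {0..1}"
    and "proxy_disparity_bound M ell v vh y \<epsilon>"
    and "\<And>e. e \<in> {0..1} \<Longrightarrow> proxy_disparity_bound M ell v vh y e \<Longrightarrow> \<epsilon> \<le> e"
    and "\<bar>r 0 - p 0\<bar> \<le> \<gamma>"
    and "\<bar>r 1 - p 1\<bar> \<le> \<gamma>"
  shows "\<bar>parity_gap M ell v y - parity_gap M ell vh y\<bar> \<le> 2 * (\<gamma> + \<epsilon>)"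
proof -
  interpret prob_space M by fact
  have [measurable]: "ell \<in> M \<rightarrow>\<^sub>M count_space UNIV" "v \<in> M \<rightarrow>\<^sub>M count_space UNIV"
      "vh \<in> M \<rightarrow>\<^sub>M count_space UNIV" "y \<in> M \<rightarrow>\<^sub>M count_space UNIV"
    using assms(2-5)[THEN measurable_compose, of "\<lambda>k. k"] by simp_all
  \<comment> \<open>Only on \<open>space M\<close> are the values confined to 0 and 1, so that being
    0 is the complement of being 1.\<close>
  have v: "v x = 0 \<longleftrightarrow> v x \<noteq> 1" and vh: "vh x = 0 \<longleftrightarrow> vh x \<noteq> 1" if "x \<in> space M" for x
    using measurable_space[OF assms(3) that] measurable_space[OF assms(4) that] by auto
  have rate: "\<bar>\<P>(x in M. y x = 1 \<bar> v x = 1 \<and> ell x = l) - \<P>(x in M. y x = 1 \<bar> vh x = 1 \<and> ell x = l)\<bar>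
      \<le> \<gamma> + \<epsilon>" if l: "l \<in> {0, 1}" for l
  proof -
    \<comment> \<open>This passes from the value 0 to the negated form. The events inside a
      conditional probability are cut down to \<open>space M\<close>, where the two agree.\<close>
    have eqs: "\<P>(x in M. y x = 1 \<bar> v x = 1 \<and> vh x = 0 \<and> ell x = l) =
        \<P>(x in M. y x = 1 \<bar> v x = 1 \<and> vh x \<noteq> 1 \<and> ell x = l)"
      "\<P>(x in M. y x = 1 \<bar> v x = 0 \<and> vh x = 1 \<and> ell x = l) =
        \<P>(x in M. y x = 1 \<bar> v x \<noteq> 1 \<and> vh x = 1 \<and> ell x = l)"
      unfolding cond_prob_def
      by (intro arg_cong2[of _ _ _ _ "(/)"] arg_cong[of _ _ prob] Collect_cong; metis v vh)+
    have "\<bar>\<P>(x in M. y x = 1 \<bar> v x = 1 \<and> vh x \<noteq> 1 \<and> ell x = l)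
        - \<P>(x in M. y x = 1 \<bar> v x \<noteq> 1 \<and> vh x = 1 \<and> ell x = l)\<bar> \<le> \<epsilon>"
      using bspec[OF assms(13)[unfolded proxy_disparity_bound_def] l] unfolding eqs .
    moreover have "\<bar>r l - p l\<bar> \<le> \<gamma>"
      using l assms(15,16) by auto
    ultimately show ?thesis
      using abs_cond_prob_diff_le[of "\<lambda>x. y x = 1" "\<lambda>x. v x = 1" "\<lambda>x. vh x = 1" "\<lambda>x. ell x = l"]
        assms(6,7,10,11)[OF l] by (simp add: abs_minus_commute)
  qed
  \<comment> \<open>The difference of the gaps is the error in group 1 minus the error in group 0,
    whence the factor 2.\<close>
  show ?thesis
    using rate[of 0] rate[of 1] unfolding parity_gap_def by simp
qed

end
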